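(* Let $f:\mathbb{R}^d\to\mathbb{R}$ be a $C^2$ function for which there are constants $0<m\le M<+\infty$ with $m\le\nabla^2 f(x)\le M$ for all $x\in\mathbb{R}^d$, and let $x^*$ be the unique global minimum of $f$. Let $\gamma>0$ and $c>0$. Fix $L>0$. Then, for any initial condition $(x_0,p_0)\in\mathbb{R}^d\times\mathbb{R}^d$ such that $\|x_0\|+\|p_0\|\le L$, there exist $\delta t^*>0$, $\kappa>0$ and $C>0$ for which, for any integer $n\ge 0$ and any $\delta t\in(0,\delta t^* )$, the iterates of the Euler scheme $$p_{n+1}=(1-\gamma\,\delta t)\,p_n-c\,\delta t\,[p_n]^3-\delta t\,\nabla f(x_n),\qquad x_{n+1}=x_n+\delta t\,p_n$$ satisfy $$f(x_n)-f(x^* )+\|p_n\|^2\le C\,\mathrm{e}^{-\kappa n\delta t}.$$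
   Context: $[p]^3$ denotes the element-wise cube of the vector $p\in\mathbb{R}^d$; $\|\cdot\|$ is the Euclidean norm; $m\le\nabla^2 f(x)\le M$ means that all eigenvalues of the Hessian of $f$ at $x$ lie in $[m,M]$. *)

theory Defs
  imports "HOL-Analysis.Analysis"
begin

definition grad :: "('a::real_inner \<Rightarrow> real) \<Rightarrow> 'a \<Rightarrow> 'a" where
  "grad f x = (THE D. GDERIV f x :> D)"

lemma grad_eqI:
  fixes f :: "'a::real_inner \<Rightarrow> real"
  assumes "GDERIV f x :> D"
  shows "grad f x = D"
  unfolding grad_def
proof (rule the_equality)
  fix D' assume "GDERIV f x :> D'"
  with assms have "(\<lambda>h. inner h D) = (\<lambda>h. inner h D')"
    unfolding gderiv_def by (rule has_derivative_unique)
  then have "inner (D' - D) D = inner (D' - D) D'"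
    by (rule fun_cong)
  then have "inner (D' - D) (D' - D) = 0"
    by (simp add: inner_diff_right)
  then show "D' = D"
    by simp
qed (rule assms)

definition hessian :: "(real ^ 'n \<Rightarrow> real) \<Rightarrow> real ^ 'n \<Rightarrow> real ^ 'n ^ 'n" where
  "hessian f x = jacobian (grad f) (at x)"

definition C2 :: "(real ^ 'n \<Rightarrow> real) \<Rightarrow> bool" where
  "C2 f \<longleftrightarrow> (\<forall>x. f differentiable (at x)) \<and> (\<forall>x. grad f differentiable (at x))
     \<and> continuous_on UNIV (hessian f)"

(* Only real eigenvalues are considered: the matrices concerned are Hessians of C2 functions,
   which are symmetric, so that their complex spectrum is real. *)
definition eigenvalue :: "real ^ 'n ^ 'n \<Rightarrow> real \<Rightarrow> bool" where
  "eigenvalue A l \<longleftrightarrow> (\<exists>v. v \<noteq> 0 \<and> A *v v = l *\<^sub>R v)"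

definition vec_cube :: "real ^ 'n \<Rightarrow> real ^ 'n" where
  "vec_cube p = (\<chi> i. (p $ i) ^ 3)"

(* The state is the pair (x, p); both components are updated from the old state. *)
primrec euler_iterate ::
  "(real ^ 'n \<Rightarrow> real) \<Rightarrow> real \<Rightarrow> real \<Rightarrow> real \<Rightarrow> (real ^ 'n) \<times> (real ^ 'n) \<Rightarrow> nat
    \<Rightarrow> (real ^ 'n) \<times> (real ^ 'n)"
where
  "euler_iterate f \<gamma> c dt z 0 = z"
| "euler_iterate f \<gamma> c dt z (Suc n) =
     (let (x, p) = euler_iterate f \<gamma> c dt z n in
       (x + dt *\<^sub>R p,
        (1 - \<gamma> * dt) *\<^sub>R p - (c * dt) *\<^sub>R vec_cube p - dt *\<^sub>R grad f x))"

end

theory Submission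
  imports Defs
begin

text \<open>
  With \<open>E = f x - f x\<^sup>* + |p|\<^sup>2 / 2\<close>, the modified energy \<open>W = E + b p \<bullet> (x - x\<^sup>*)\<close> satisfies
  \<open>E / 2 \<le> W \<le> 2 E\<close> for small \<open>b\<close>. One Euler step changes \<open>W\<close> by at most
  \<open>- \<beta> dt E + A dt\<^sup>2 E\<close>: friction dissipates the momentum, the cross term together with strong
  convexity dissipates the potential energy, and the second-order remainder is controlled by \<open>E\<close> as
  \<open>|\<nabla>f|\<^sup>2 \<le> 2 M (f x - f x\<^sup>*)\<close>. The cubic friction behaves like a linear one as long as \<open>p\<close> is
  bounded; the sublevel set \<open>W \<le> 2 E\<^sub>0\<close> gives such a bound and is invariant because \<open>W\<close> decreases,
  so \<open>b\<close> and the step size depend only on the initial energy \<open>E\<^sub>0\<close>.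
\<close>

section \<open>Second-order calculus\<close>

lemma gderiv_grad:
  fixes f :: "'a::euclidean_space \<Rightarrow> real"
  assumes "f differentiable (at x)"
  shows "GDERIV f x :> grad f x"
proof -
  obtain D where D: "(f has_derivative D) (at x)"
    using assms by (auto simp: differentiable_def)
  then have "linear D"
    by (rule has_derivative_linear)
  \<comment> \<open>Riesz representation: a linear functional is the inner product with its adjoint
    applied to 1.\<close>
  then have "D = (\<lambda>h. inner h (adjoint D 1))"
    by (simp add: adjoint_works)
  then have "GDERIV f x :> adjoint D 1"
    using D unfolding gderiv_def by simp
  then show ?thesis
    using grad_eqI by metis
qed

lemma has_real_derivative_along_line:
  fixes f :: "'a::real_inner \<Rightarrow> real"
  assumes "GDERIV f (a + t *\<^sub>R h) :> D"
  shows "((\<lambda>t. f (a + t *\<^sub>R h)) has_real_derivative h \<bullet> D) (at t)"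
proof -
  have "((\<lambda>t. a + t *\<^sub>R h) has_derivative (\<lambda>s. s *\<^sub>R h)) (at t)"
    by (auto intro!: derivative_eq_intros)
  from has_derivative_compose[OF this assms[unfolded gderiv_def]]
  show ?thesis
    by (simp add: has_field_derivative_def mult_commute_abs)
qed

lemma grad_has_derivative_along_line:
  fixes f :: "real ^ 'n \<Rightarrow> real"
  assumes "grad f differentiable (at (a + t *\<^sub>R h))"
  shows "((\<lambda>t. v \<bullet> grad f (a + t *\<^sub>R h)) has_real_derivative
    v \<bullet> (hessian f (a + t *\<^sub>R h) *v h)) (at t)"
proof -
  have H: "(grad f has_derivative (\<lambda>k. hessian f (a + t *\<^sub>R h) *v k)) (at (a + t *\<^sub>R h))"
    using assms unfolding hessian_def by (simp flip: jacobian_works)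
  have "((\<lambda>t. a + t *\<^sub>R h) has_derivative (\<lambda>s. s *\<^sub>R h)) (at t)"
    by (auto intro!: derivative_eq_intros)
  from has_derivative_inner_right[OF has_derivative_compose[OF this H], of v]
  show ?thesis
    by (simp add: has_field_derivative_def matrix_vector_mult_scaleR mult_commute_abs)
qed

section \<open>Symmetry of the Hessian\<close>

text \<open>The mean value theorem is applied twice, first along \<open>u\<close> to a difference in
  direction \<open>v\<close>, then along \<open>v\<close> to the resulting gradient term. The
  left-hand side is symmetric in \<open>u\<close> and \<open>v\<close> while the right-hand side is
  not visibly so, and symmetry of the Hessian is read off from this.\<close>

lemma second_difference_hessian:
  fixes f :: "real ^ 'n \<Rightarrow> real"
  assumes "C2 f" and "e > 0"
  obtains s t where "0 < s" "s < e" "0 < t" "t < e"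
    and "f (x + e *\<^sub>R u + e *\<^sub>R v) - f (x + e *\<^sub>R u) - f (x + e *\<^sub>R v) + f x
      = e\<^sup>2 * (u \<bullet> (hessian f (x + s *\<^sub>R u + t *\<^sub>R v) *v v))"
proof -
  have df: "GDERIV f y :> grad f y" and dg: "grad f differentiable (at y)" for y
    using assms gderiv_grad by (auto simp: C2_def)
  define F where "F s = f (x + e *\<^sub>R v + s *\<^sub>R u) - f (x + s *\<^sub>R u)" for s
  have "(F has_real_derivative
      u \<bullet> grad f (x + e *\<^sub>R v + s *\<^sub>R u) - u \<bullet> grad f (x + s *\<^sub>R u)) (at s)" for s
    unfolding F_def by (intro DERIV_diff has_real_derivative_along_line df)
  from MVT2[OF \<open>e > 0\<close> this] obtain s where s: "0 < s" "s < e"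
    and Fs: "F e - F 0 = e * (u \<bullet> grad f (x + e *\<^sub>R v + s *\<^sub>R u) - u \<bullet> grad f (x + s *\<^sub>R u))"
    by auto
  define G where "G t = u \<bullet> grad f (x + s *\<^sub>R u + t *\<^sub>R v)" for t
  have "(G has_real_derivative u \<bullet> (hessian f (x + s *\<^sub>R u + t *\<^sub>R v) *v v)) (at t)" for t
    unfolding G_def by (intro grad_has_derivative_along_line dg)
  from MVT2[OF \<open>e > 0\<close> this] obtain t where t: "0 < t" "t < e"
    and Gt: "G e - G 0 = e * (u \<bullet> (hessian f (x + s *\<^sub>R u + t *\<^sub>R v) *v v))"
    by auto
  show thesis
  proof (rule that[OF s t])
    have "F e - F 0 = e * (G e - G 0)"
      unfolding Fs by (simp add: G_def ac_simps)
    then have "F e - F 0 = e\<^sup>2 * (u \<bullet> (hessian f (x + s *\<^sub>R u + t *\<^sub>R v) *v v))"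
      unfolding Gt by (simp add: power2_eq_square)
    then show "f (x + e *\<^sub>R u + e *\<^sub>R v) - f (x + e *\<^sub>R u) - f (x + e *\<^sub>R v) + f x
      = e\<^sup>2 * (u \<bullet> (hessian f (x + s *\<^sub>R u + t *\<^sub>R v) *v v))"
      by (simp add: F_def ac_simps)
  qed
qed

text \<open>One second difference, divided by the squared step, equals both mixed forms at points
  close to \<open>x\<close>; continuity of the Hessian identifies the two limits. Symmetry is what
  turns bounds on eigenvalues into bounds on the quadratic form.\<close>

lemma hessian_symmetric:
  fixes f :: "real ^ 'n \<Rightarrow> real"
  assumes "C2 f"
  shows "u \<bullet> (hessian f x *v v) = v \<bullet> (hessian f x *v u)"
proof -
  define e where "e n = inverse (real (Suc n))" for n
  have e_pos: "e n > 0" for n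
    by (simp add: e_def)
  have e_lim: "e \<longlonglongrightarrow> 0"
    unfolding e_def by (rule LIMSEQ_inverse_real_of_nat)
  have cont: "isCont (\<lambda>y. a \<bullet> (hessian f y *v b)) x" for a b
  proof -
    have "continuous_on UNIV (\<lambda>y. a \<bullet> (hessian f y *v b))"
      using assms unfolding C2_def inner_vec_def matrix_vector_mult_def
      by (auto intro!: continuous_intros)
    then show ?thesis
      by (simp add: continuous_on_eq_continuous_at)
  qed
  have squeeze: "s \<longlonglongrightarrow> 0" if "\<And>n. 0 < s n" "\<And>n. s n < e n" for s
    by (rule tendsto_sandwich[OF _ _ tendsto_const e_lim])
      (use that in \<open>auto intro: less_imp_le always_eventually\<close>)
  have lim: "(\<lambda>n. x + s n *\<^sub>R a + t n *\<^sub>R b) \<longlonglongrightarrow> x" if "s \<longlonglongrightarrow> 0" "t \<longlonglongrightarrow> 0" for s t a b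
  proof -
    have "(\<lambda>n. x + s n *\<^sub>R a + t n *\<^sub>R b) \<longlonglongrightarrow> x + 0 *\<^sub>R a + 0 *\<^sub>R b"
      by (intro tendsto_intros that)
    then show ?thesis by simp
  qed
  define D where "D n = f (x + e n *\<^sub>R u + e n *\<^sub>R v) - f (x + e n *\<^sub>R u) - f (x + e n *\<^sub>R v) + f x" for n
  have "\<exists>s t. 0 < s \<and> s < e n \<and> 0 < t \<and> t < e n \<and>
      D n = (e n)\<^sup>2 * (u \<bullet> (hessian f (x + s *\<^sub>R u + t *\<^sub>R v) *v v))" for n
    unfolding D_def using second_difference_hessian[OF assms e_pos, of n x u v] by metis
  then obtain s t where st: "\<And>n. 0 < s n" "\<And>n. s n < e n" "\<And>n. 0 < t n" "\<And>n. t n < e n"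
      "\<And>n. D n = (e n)\<^sup>2 * (u \<bullet> (hessian f (x + s n *\<^sub>R u + t n *\<^sub>R v) *v v))"
    by metis
  \<comment> \<open>Exchanging the roles of \<open>u\<close> and \<open>v\<close> leaves
    \<open>D n\<close> unchanged, so the same number has a second representation.\<close>
  have "D n = f (x + e n *\<^sub>R v + e n *\<^sub>R u) - f (x + e n *\<^sub>R v) - f (x + e n *\<^sub>R u) + f x" for n
    by (simp add: D_def ac_simps)
  then have "\<exists>s t. 0 < s \<and> s < e n \<and> 0 < t \<and> t < e n \<and>
      D n = (e n)\<^sup>2 * (v \<bullet> (hessian f (x + s *\<^sub>R v + t *\<^sub>R u) *v u))" for n
    using second_difference_hessian[OF assms e_pos, of n x v u] by metis
  then obtain s' t' where st': "\<And>n. 0 < s' n" "\<And>n. s' n < e n" "\<And>n. 0 < t' n" "\<And>n. t' n < e n"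
      "\<And>n. D n = (e n)\<^sup>2 * (v \<bullet> (hessian f (x + s' n *\<^sub>R v + t' n *\<^sub>R u) *v u))"
    by metis
  have "(\<lambda>n. u \<bullet> (hessian f (x + s n *\<^sub>R u + t n *\<^sub>R v) *v v)) \<longlonglongrightarrow> u \<bullet> (hessian f x *v v)"
    by (intro isCont_tendsto_compose[OF cont] lim squeeze st)
  moreover have "(\<lambda>n. v \<bullet> (hessian f (x + s' n *\<^sub>R v + t' n *\<^sub>R u) *v u)) \<longlonglongrightarrow> v \<bullet> (hessian f x *v u)"
    by (intro isCont_tendsto_compose[OF cont] lim squeeze st')
  moreover have "u \<bullet> (hessian f (x + s n *\<^sub>R u + t n *\<^sub>R v) *v v)
      = v \<bullet> (hessian f (x + s' n *\<^sub>R v + t' n *\<^sub>R u) *v u)" for n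
    using st(5)[of n] st'(5)[of n] less_imp_neq[OF e_pos[of n]] by simp
  ultimately show ?thesis
    using LIMSEQ_unique by simp
qed

section \<open>From eigenvalues to quadratic bounds and Taylor expansion\<close>

text \<open>A maximizer of the Rayleigh quotient on the unit sphere is an eigenvector: otherwise moving it
  against the residual \<open>r\<close> would increase the quotient.\<close>

lemma selfadjoint_max_eigenvector:
  fixes T :: "'a::euclidean_space \<Rightarrow> 'a"
  assumes "linear T" and sym: "\<And>u v. u \<bullet> T v = v \<bullet> T u"
  obtains v l where "v \<noteq> 0" "T v = l *\<^sub>R v" "\<And>w. w \<bullet> T w \<le> l * (norm w)\<^sup>2"
proof -
  interpret linear T by fact
  have "continuous_on (sphere 0 1) (\<lambda>w. w \<bullet> T w)"
    by (intro continuous_intros linear_continuous_on linear_conv_bounded_linear[THEN iffD1] \<open>linear T\<close>)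
  moreover have "sphere (0::'a) 1 \<noteq> {}"
    by simp
  ultimately obtain v where "v \<in> sphere 0 1" "\<forall>w\<in>sphere 0 1. w \<bullet> T w \<le> v \<bullet> T v"
    using continuous_attains_sup[OF compact_sphere] by blast
  then have v: "norm v = 1" and max: "norm w = 1 \<Longrightarrow> w \<bullet> T w \<le> v \<bullet> T v" for w
    by simp_all
  define l where "l = v \<bullet> T v"
  have bound: "w \<bullet> T w \<le> l * (norm w)\<^sup>2" for w
  proof (cases "w = 0")
    case False
    define a where "a = norm w"
    define z where "z = w /\<^sub>R a"
    have "a > 0" "norm z = 1" "w = a *\<^sub>R z"
      using False by (auto simp: a_def z_def)
    then have "w \<bullet> T w = a\<^sup>2 * (z \<bullet> T z)"
      by (simp add: scale power2_eq_square)
    also have "\<dots> \<le> a\<^sup>2 * l"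
      unfolding l_def by (intro mult_left_mono max) (auto simp: \<open>norm z = 1\<close>)
    finally show ?thesis
      by (simp add: a_def mult.commute)
  qed (simp add: zero)
  define r where "r = l *\<^sub>R v - T v"
  have "v \<bullet> r = 0"
    using v by (simp add: r_def l_def inner_diff_right dot_square_norm)
  have "r = 0"
  proof (rule ccontr)
    assume "r \<noteq> 0"
    define k where "k = l * (norm r)\<^sup>2 - r \<bullet> T r"
    define q where "q = (norm r)\<^sup>2"
    have "q > 0"
      using \<open>r \<noteq> 0\<close> by (simp add: q_def)
    have "r \<bullet> T v = - q"
    proof -
      have "r \<bullet> T v = r \<bullet> (l *\<^sub>R v - r)"
        by (simp add: r_def)
      also have "\<dots> = - q"
        using \<open>v \<bullet> r = 0\<close> by (simp add: inner_diff_right inner_commute q_def dot_square_norm)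
      finally show ?thesis .
    qed
    \<comment> \<open>Testing the Rayleigh bound at \<open>v - t *\<^sub>R r\<close> gives a
      polynomial in \<open>t\<close> without constant term. Its linear coefficient
      \<open>- 2 * q\<close> is negative, which is impossible for small positive
      \<open>t\<close>.\<close>
    have quadratic: "0 \<le> t\<^sup>2 * k - 2 * t * q" for t :: real
    proof -
      have "(v - t *\<^sub>R r) \<bullet> T (v - t *\<^sub>R r) \<le> l * (norm (v - t *\<^sub>R r))\<^sup>2"
        by (rule bound)
      also have "(norm (v - t *\<^sub>R r))\<^sup>2 = 1 + t\<^sup>2 * q"
        using v \<open>v \<bullet> r = 0\<close> unfolding q_def power2_norm_eq_inner
        by (simp add: inner_diff_left inner_diff_right inner_commute power2_eq_square norm_eq_1)
      also have "(v - t *\<^sub>R r) \<bullet> T (v - t *\<^sub>R r) = l + 2 * t * q + t\<^sup>2 * (r \<bullet> T r)"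
        using \<open>r \<bullet> T v = - q\<close> sym[of v r]
        by (simp add: diff scale inner_diff_left inner_diff_right l_def power2_eq_square algebra_simps)
      finally show ?thesis
        by (simp add: k_def q_def algebra_simps)
    qed
    \<comment> \<open>With \<open>t = q / a\<close> the quadratic term is less than the linear one,
      whatever the sign or size of \<open>k\<close>; the summand 1 keeps \<open>a\<close> positive
      when \<open>k\<close> vanishes.\<close>
    define a where "a = \<bar>k\<bar> + 1"
    have "a > 0" "k / a < 2"
      by (auto simp: a_def field_simps)
    have "0 \<le> (q / a)\<^sup>2 * k - 2 * (q / a) * q"
      by (rule quadratic)
    also have "\<dots> = q\<^sup>2 / a * (k / a - 2)"
      by (simp add: power2_eq_square right_diff_distrib)
    also have "\<dots> < 0"
      using \<open>q > 0\<close> \<open>a > 0\<close> \<open>k / a < 2\<close> by (intro mult_pos_neg) auto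
    finally show False by simp
  qed
  show thesis
  proof (rule that[OF _ _ bound])
    show "v \<noteq> 0" using v by auto
    show "T v = l *\<^sub>R v" using \<open>r = 0\<close> by (simp add: r_def)
  qed
qed

text \<open>The maximum of the Rayleigh quotient is an eigenvalue, hence at most \<open>M\<close>.
  The same argument for the negated Hessian gives the lower bound.\<close>

lemma hessian_quadratic_bounds:
  fixes f :: "real ^ 'n \<Rightarrow> real"
  assumes "C2 f" and ev: "\<forall>l. eigenvalue (hessian f x) l \<longrightarrow> m \<le> l \<and> l \<le> M"
  shows "m * (norm w)\<^sup>2 \<le> w \<bullet> (hessian f x *v w)" and "w \<bullet> (hessian f x *v w) \<le> M * (norm w)\<^sup>2"
proof -
  let ?T = "\<lambda>v. hessian f x *v v"
  have sym: "u \<bullet> ?T v = v \<bullet> ?T u" for u v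
    by (rule hessian_symmetric[OF \<open>C2 f\<close>])
  obtain v l where "v \<noteq> 0" "?T v = l *\<^sub>R v" and l: "w \<bullet> ?T w \<le> l * (norm w)\<^sup>2" for w
    using selfadjoint_max_eigenvector[OF matrix_vector_mul_linear sym] by metis
  then have "l \<le> M"
    using ev by (auto simp: eigenvalue_def)
  then show "w \<bullet> ?T w \<le> M * (norm w)\<^sup>2"
    using l[of w] mult_right_mono[of l M "(norm w)\<^sup>2"] by simp
  have "linear (\<lambda>v. - ?T v)"
    by (intro linear_compose_neg matrix_vector_mul_linear)
  moreover have "u \<bullet> - ?T v = v \<bullet> - ?T u" for u v
    using sym[of u v] by simp
  ultimately obtain v l where "v \<noteq> 0" "- ?T v = l *\<^sub>R v" and l: "w \<bullet> - ?T w \<le> l * (norm w)\<^sup>2" for w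
    using selfadjoint_max_eigenvector[of "\<lambda>v. - ?T v"] by metis
  then have "?T v = (- l) *\<^sub>R v"
    by (metis minus_minus scaleR_minus_left)
  then have "m \<le> - l"
    using ev \<open>v \<noteq> 0\<close> unfolding eigenvalue_def by blast
  then show "m * (norm w)\<^sup>2 \<le> w \<bullet> ?T w"
    using l[of w] mult_right_mono[of m "- l" "(norm w)\<^sup>2"] by simp
qed

lemma taylor_hessian:
  fixes f :: "real ^ 'n \<Rightarrow> real"
  assumes "C2 f"
  obtains z where "f (x + h) = f x + h \<bullet> grad f x + h \<bullet> (hessian f z *v h) / 2"
proof -
  have df: "GDERIV f y :> grad f y" and dg: "grad f differentiable (at y)" for y
    using assms gderiv_grad by (auto simp: C2_def)
  \<comment> \<open>\<open>d k\<close> is the \<open>k\<close>-th derivative along the segment;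
    index 2 supplies the Lagrange remainder.\<close>
  define d where "d k t = (if k = 0 then f (x + t *\<^sub>R h) else if k = 1 then h \<bullet> grad f (x + t *\<^sub>R h)
    else h \<bullet> (hessian f (x + t *\<^sub>R h) *v h))" for k :: nat and t
  have "\<forall>k t. k < 2 \<and> 0 \<le> t \<and> t \<le> 1 \<longrightarrow> DERIV (d k) t :> d (Suc k) t"
  proof (intro allI impI)
    fix k :: nat and t :: real
    assume "k < 2 \<and> 0 \<le> t \<and> t \<le> 1"
    then consider "k = 0" | "k = 1" by linarith
    then show "DERIV (d k) t :> d (Suc k) t"
    proof cases
      case 1
      then show ?thesis
        using has_real_derivative_along_line[OF df, where a = x and t = t and h = h]
          by (simp add: d_def[abs_def])
    next
      case 2
      then show ?thesis
        using grad_has_derivative_along_line[OF dg, where v = h and a = x and t = t and h = h]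
          by (simp add: d_def[abs_def])
    qed
  qed
  from Taylor_up[OF _ refl this, of 0]
  obtain t where "d 0 1 = d 0 0 + d 1 0 + d 2 t / 2"
    by (auto simp: numeral_2_eq_2)
  then have "f (x + h) = f x + h \<bullet> grad f x + h \<bullet> (hessian f (x + t *\<^sub>R h) *v h) / 2"
    by (simp add: d_def)
  then show thesis
    by (rule that)
qed

section \<open>Convexity estimates\<close>

lemma taylor_hessian_bounds:
  fixes f :: "real ^ 'n \<Rightarrow> real"
  assumes "C2 f" and ev: "\<forall>x l. eigenvalue (hessian f x) l \<longrightarrow> m \<le> l \<and> l \<le> M"
  shows "f x + h \<bullet> grad f x + m / 2 * (norm h)\<^sup>2 \<le> f (x + h)"
    and "f (x + h) \<le> f x + h \<bullet> grad f x + M / 2 * (norm h)\<^sup>2"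
proof -
  obtain z where "f (x + h) = f x + h \<bullet> grad f x + h \<bullet> (hessian f z *v h) / 2"
    using taylor_hessian[OF \<open>C2 f\<close>] .
  then show "f x + h \<bullet> grad f x + m / 2 * (norm h)\<^sup>2 \<le> f (x + h)"
    and "f (x + h) \<le> f x + h \<bullet> grad f x + M / 2 * (norm h)\<^sup>2"
    using hessian_quadratic_bounds[OF \<open>C2 f\<close> spec[OF ev], of h z] by auto
qed

text \<open>These are the only facts about the potential that the energy argument uses besides the
  quadratic upper bound: the first makes the modified energy comparable to the energy, the second
  controls second-order terms, and the third provides dissipation through the cross term.\<close>

lemma convexity_at_minimizer:
  fixes f :: "real ^ 'n \<Rightarrow> real"
  assumes "C2 f" and "0 < m" and "m \<le> M"
    and ev: "\<forall>x l. eigenvalue (hessian f x) l \<longrightarrow> m \<le> l \<and> l \<le> M"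
    and min: "\<And>y. f a \<le> f y"
  shows "m / 2 * (norm (x - a))\<^sup>2 \<le> f x - f a"
    and "(norm (grad f x))\<^sup>2 \<le> 2 * M * (f x - f a)"
    and "f x - f a + m / 2 * (norm (x - a))\<^sup>2 \<le> (x - a) \<bullet> grad f x"
proof -
  have "M > 0" using assms by linarith
  note bounds = taylor_hessian_bounds[OF \<open>C2 f\<close> ev]
  have grad_bound: "(norm (grad f z))\<^sup>2 \<le> 2 * M * (f z - f a)" for z
  proof -
    \<comment> \<open>a gradient step of length \<open>1 / M\<close> minimizes the quadratic upper bound\<close>
    have "f a \<le> f (z + (- 1 / M) *\<^sub>R grad f z)"
      by (rule min)
    also have "\<dots> \<le> f z + ((- 1 / M) *\<^sub>R grad f z) \<bullet> grad f z
        + M / 2 * (norm ((- 1 / M) *\<^sub>R grad f z))\<^sup>2"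
      by (rule bounds(2))
    also have "\<dots> = f z - (norm (grad f z))\<^sup>2 / (2 * M)"
      using \<open>M > 0\<close> by (simp add: dot_square_norm power_mult_distrib power_divide power2_eq_square field_simps)
    finally show ?thesis
      using \<open>M > 0\<close> by (simp add: field_simps)
  qed
  then show "(norm (grad f x))\<^sup>2 \<le> 2 * M * (f x - f a)" .
  \<comment> \<open>At \<open>a\<close> itself the gradient bound has right-hand side 0.\<close>
  have "grad f a = 0"
    using grad_bound[of a] by simp
  then show "m / 2 * (norm (x - a))\<^sup>2 \<le> f x - f a"
    using bounds(1)[of a "x - a"] by simp
  show "f x - f a + m / 2 * (norm (x - a))\<^sup>2 \<le> (x - a) \<bullet> grad f x"
    \<comment> \<open>The expansion is made at \<open>x\<close> and evaluated at the
      minimizer.\<close>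
    using bounds(1)[of x "a - x"] by (simp add: norm_minus_commute inner_diff_left)
qed

section \<open>Decay of the modified energy\<close>

lemma inner_vec_cube_nonneg: "0 \<le> p \<bullet> vec_cube p"
proof -
  have "p \<bullet> vec_cube p = (\<Sum>i\<in>UNIV. ((p $ i)\<^sup>2)\<^sup>2)"
    unfolding inner_vec_def vec_cube_def
    by (intro sum.cong) (simp_all add: power2_eq_square power3_eq_cube ac_simps)
  then show ?thesis
    by (simp add: sum_nonneg)
qed

text \<open>Each component of the cube is the component of \<open>p\<close> times its square, which
  is at most \<open>B\<close>. So cubic friction grows at most linearly where the momentum is
  bounded.\<close>

lemma norm_vec_cube_le:
  assumes "(norm p)\<^sup>2 \<le> B"
  shows "norm (vec_cube p) \<le> B * norm p"
proof -
  have "0 \<le> B"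
    using assms order_trans[OF zero_le_power2] by blast
  have "norm (vec_cube p $ i) \<le> norm ((B *\<^sub>R p) $ i)" for i
  proof -
    have "\<bar>p $ i\<bar>\<^sup>2 \<le> (norm p)\<^sup>2"
      by (intro power_mono component_le_norm_cart) simp
    then have "(p $ i)\<^sup>2 \<le> B"
      using assms by simp
    then have "(p $ i)\<^sup>2 * \<bar>p $ i\<bar> \<le> B * \<bar>p $ i\<bar>"
      by (intro mult_right_mono) simp_all
    then show ?thesis
      using \<open>0 \<le> B\<close> by (simp add: vec_cube_def power2_eq_square power3_eq_cube abs_mult)
  qed
  then have "norm (vec_cube p) \<le> norm (B *\<^sub>R p)"
    by (rule norm_le_componentwise_cart)
  then show ?thesis
    using \<open>0 \<le> B\<close> by simp
qed

text \<open>The vector \<open>r\<close> is the friction force, \<open>y\<close> the displacement from the minimizer,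
  and \<open>G\<close>, \<open>G'\<close> are the excess potential energies before and after the step.\<close>

lemma modified_energy_step:
  fixes p y g r :: "'a::real_inner"
  assumes "0 < m" "0 \<le> M" "0 \<le> G" "0 < dt" "0 < b" "b \<le> 1"
    and friction: "\<gamma> * (norm p)\<^sup>2 \<le> p \<bullet> r" "norm r \<le> K * norm p"
    and convex: "G + m / 2 * (norm y)\<^sup>2 \<le> y \<bullet> g" "(norm g)\<^sup>2 \<le> 2 * M * G"
    and descent: "G' \<le> G + dt * (p \<bullet> g) + M / 2 * (dt\<^sup>2 * (norm p)\<^sup>2)"
    and b: "b * (1 + K\<^sup>2 / (2 * m)) \<le> \<gamma> / 2"
    and \<beta>: "\<beta> \<le> \<gamma>" "\<beta> \<le> b"
    and q: "q = r + g"
  defines "E \<equiv> G + (norm p)\<^sup>2 / 2"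
  shows "G' + (norm (p - dt *\<^sub>R q))\<^sup>2 / 2 + b * ((p - dt *\<^sub>R q) \<bullet> (y + dt *\<^sub>R p))
    \<le> E + b * (p \<bullet> y) - dt * \<beta> * E + dt\<^sup>2 * (1 + 4 * K\<^sup>2 + 5 * M) * E"
proof -
  define P where "P = (norm p)\<^sup>2"
  have "P \<ge> 0" by (simp add: P_def)
  have r2: "(norm r)\<^sup>2 \<le> K\<^sup>2 * P"
    using power_mono[OF friction(2) norm_ge_zero, of 2] by (simp add: power_mult_distrib P_def)
  \<comment> \<open>Young's inequality with weight \<open>m\<close>, so that the term in
    \<open>y\<close> is exactly what strong convexity absorbs in \<open>convex(1)\<close>.\<close>
  have young: "- (r \<bullet> y) \<le> K\<^sup>2 / (2 * m) * P + m / 2 * (norm y)\<^sup>2"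
  proof -
    have "0 \<le> (norm (r + m *\<^sub>R y))\<^sup>2"
      by simp
    also have "\<dots> = (norm r)\<^sup>2 + 2 * m * (r \<bullet> y) + m\<^sup>2 * (norm y)\<^sup>2"
      unfolding power2_norm_eq_inner
      by (simp add: inner_add_left inner_add_right inner_commute power2_eq_square algebra_simps)
    finally have "2 * m * (- (r \<bullet> y)) \<le> K\<^sup>2 * P + m\<^sup>2 * (norm y)\<^sup>2"
      using r2 by simp
    then show ?thesis
      using \<open>0 < m\<close> by (simp add: field_simps power2_eq_square)
  qed
  \<comment> \<open>This is the coefficient of \<open>dt\<close>. By the condition on
    \<open>b\<close> the cross term consumes at most half of the friction, leaving
    \<open>\<gamma> / 2 * P\<close> besides the potential dissipation \<open>b * G\<close>.\<close>
  have first_order: "- (p \<bullet> r) + b * P - b * (q \<bullet> y) \<le> - \<beta> * E"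
  proof -
    define k where "k = K\<^sup>2 / (2 * m)"
    have "- (q \<bullet> y) \<le> K\<^sup>2 / (2 * m) * P - G"
      using young convex(1) by (simp add: q inner_add_left inner_add_right inner_commute)
    then have "b * - (q \<bullet> y) \<le> b * (k * P - G)"
      using \<open>0 < b\<close> unfolding k_def by (intro mult_left_mono) auto
    moreover have "b * (1 + k) * P \<le> \<gamma> / 2 * P"
      using b \<open>P \<ge> 0\<close> unfolding k_def by (rule mult_right_mono)
    ultimately have "- (p \<bullet> r) + b * P - b * (q \<bullet> y) \<le> - \<gamma> / 2 * P - b * G"
      using friction(1) unfolding P_def[symmetric] by (simp add: algebra_simps)
    also have "\<dots> \<le> - \<beta> * E"
      using mult_right_mono[OF \<beta>(1) \<open>P \<ge> 0\<close>] mult_right_mono[OF \<beta>(2) \<open>0 \<le> G\<close>]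
      by (simp add: E_def P_def algebra_simps)
    finally show ?thesis .
  qed
  \<comment> \<open>This is the coefficient of \<open>dt\<^sup>2\<close>. The parallelogram law
    bounds the total force by friction and gradient separately.\<close>
  have second_order: "M / 2 * P + (norm q)\<^sup>2 / 2 - b * (q \<bullet> p) \<le> (1 + 4 * K\<^sup>2 + 5 * M) * E"
  proof -
    have "(norm q)\<^sup>2 + (norm (r - g))\<^sup>2 = 2 * (norm r)\<^sup>2 + 2 * (norm g)\<^sup>2"
      by (simp add: q power2_norm_eq_inner inner_add_left inner_add_right
          inner_diff_left inner_diff_right inner_commute)
    moreover have "0 \<le> (norm (r - g))\<^sup>2"
      by simp
    ultimately have q2: "(norm q)\<^sup>2 \<le> 2 * K\<^sup>2 * P + 4 * M * G"
      using r2 convex(2) by linarith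
    have "- b * (q \<bullet> p) \<le> \<bar>q \<bullet> p\<bar>"
    proof -
      have "- b * (q \<bullet> p) \<le> b * \<bar>q \<bullet> p\<bar>"
        using \<open>0 < b\<close> by (simp add: abs_if)
      also have "\<dots> \<le> 1 * \<bar>q \<bullet> p\<bar>"
        using \<open>b \<le> 1\<close> by (intro mult_right_mono) auto
      finally show ?thesis by simp
    qed
    also have "\<dots> \<le> norm q * norm p"
      by (rule Cauchy_Schwarz_ineq2)
    also have "\<dots> \<le> ((norm q)\<^sup>2 + P) / 2"
      using sum_squares_bound[of "norm q" "norm p"] by (simp add: P_def)
    finally have "M / 2 * P + (norm q)\<^sup>2 / 2 - b * (q \<bullet> p) \<le> M / 2 * P + (norm q)\<^sup>2 + P / 2"
      by (simp add: add_divide_distrib)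
    also have "\<dots> \<le> (1 / 2 + 2 * K\<^sup>2 + M / 2) * P + 4 * M * G"
      using q2 by (simp add: algebra_simps)
    also have "\<dots> \<le> (1 + 4 * K\<^sup>2 + 5 * M) * E"
    proof -
      have "0 \<le> M * P" "0 \<le> M * G" "0 \<le> K\<^sup>2 * G"
        using \<open>0 \<le> M\<close> \<open>0 \<le> G\<close> \<open>P \<ge> 0\<close> by simp_all
      then show ?thesis
        using \<open>0 \<le> G\<close> by (simp add: E_def P_def[symmetric] algebra_simps)
    qed
    finally show ?thesis .
  qed
  have norm_p': "(norm (p - dt *\<^sub>R q))\<^sup>2 = P - 2 * dt * (p \<bullet> q) + dt\<^sup>2 * (norm q)\<^sup>2"
    unfolding P_def power2_norm_eq_inner
    by (simp add: inner_diff_left inner_diff_right inner_commute power2_eq_square algebra_simps)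
  have inner_p': "(p - dt *\<^sub>R q) \<bullet> (y + dt *\<^sub>R p)
      = p \<bullet> y + dt * P - dt * (q \<bullet> y) - dt\<^sup>2 * (q \<bullet> p)"
    unfolding P_def power2_norm_eq_inner
    by (simp add: inner_diff_left inner_add_right power2_eq_square algebra_simps)
  \<comment> \<open>The contribution of \<open>p \<bullet> g\<close> to the kinetic energy cancels
    the first-order term in \<open>descent\<close>, so only friction and the cross term remain at
    order \<open>dt\<close>.\<close>
  have "p \<bullet> q = p \<bullet> r + p \<bullet> g"
    by (simp add: q inner_add_right)
  then have "G' + (norm (p - dt *\<^sub>R q))\<^sup>2 / 2 + b * ((p - dt *\<^sub>R q) \<bullet> (y + dt *\<^sub>R p))
      \<le> E + b * (p \<bullet> y) + dt * (- (p \<bullet> r) + b * P - b * (q \<bullet> y))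
        + dt\<^sup>2 * (M / 2 * P + (norm q)\<^sup>2 / 2 - b * (q \<bullet> p))"
    using descent unfolding norm_p' inner_p' E_def P_def[symmetric]
    by (simp add: algebra_simps add_divide_distrib diff_divide_distrib)
  also have "\<dots> \<le> E + b * (p \<bullet> y) + dt * (- \<beta> * E) + dt\<^sup>2 * ((1 + 4 * K\<^sup>2 + 5 * M) * E)"
    using \<open>0 < dt\<close> by (intro add_mono order_refl mult_left_mono first_order second_order) auto
  finally show ?thesis
    by (simp add: mult.assoc)
qed

text \<open>Both factors of the cross term are controlled by the energy, \<open>y\<close> through
  quadratic growth at the minimizer; the condition on \<open>b\<close> keeps the cross term below
  half of \<open>E\<close>.\<close>

lemma modified_energy_equivalent:
  fixes p y :: "'a::real_inner"
  assumes "0 < m" "0 < b" and b: "b * (1 + 1 / m) \<le> 1 / 2"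
    and G: "m / 2 * (norm y)\<^sup>2 \<le> G"
  defines "E \<equiv> G + (norm p)\<^sup>2 / 2"
  shows "E / 2 \<le> E + b * (p \<bullet> y)" "E + b * (p \<bullet> y) \<le> 2 * E"
proof -
  have "G \<ge> 0"
    using order_trans[OF _ G, of 0] \<open>0 < m\<close> by simp
  then have "E \<ge> 0"
    by (simp add: E_def)
  have "\<bar>p \<bullet> y\<bar> \<le> norm p * norm y"
    by (rule Cauchy_Schwarz_ineq2)
  also have "\<dots> \<le> ((norm p)\<^sup>2 + (norm y)\<^sup>2) / 2"
    using sum_squares_bound[of "norm p" "norm y"] by simp
  also have "\<dots> \<le> (norm p)\<^sup>2 / 2 + G / m"
    using G \<open>0 < m\<close> by (simp add: field_simps)
  also have "\<dots> \<le> (1 + 1 / m) * E"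
    using \<open>G \<ge> 0\<close> \<open>0 < m\<close> by (simp add: E_def field_simps)
  finally have "b * \<bar>p \<bullet> y\<bar> \<le> b * ((1 + 1 / m) * E)"
    using \<open>0 < b\<close> by simp
  also have "\<dots> = (b * (1 + 1 / m)) * E"
    by simp
  also have "\<dots> \<le> 1 / 2 * E"
    using b \<open>E \<ge> 0\<close> by (rule mult_right_mono)
  finally have "\<bar>b * (p \<bullet> y)\<bar> \<le> E / 2"
    using \<open>0 < b\<close> by (simp add: abs_mult)
  then show "E / 2 \<le> E + b * (p \<bullet> y)" "E + b * (p \<bullet> y) \<le> 2 * E"
    using \<open>E \<ge> 0\<close> by linarith+
qed

section \<open>Choice of constants and induction along the scheme\<close>

theorem theorem4:
  fixes f :: "real ^ 'n \<Rightarrow> real"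
    and xstar x0 p0 :: "real ^ 'n"
    and m M \<gamma> c L :: real
  assumes "C2 f"
    and "0 < m" and "m \<le> M"
    and "\<And>x l. eigenvalue (hessian f x) l \<Longrightarrow> m \<le> l \<and> l \<le> M"
    and "is_arg_min f (\<lambda>_. True) xstar"
    and "\<And>y. is_arg_min f (\<lambda>_. True) y \<Longrightarrow> y = xstar"
    and "\<gamma> > 0" and "c > 0"
    and "L > 0"
    and "norm x0 + norm p0 \<le> L"
  shows "\<exists>dtstar>0. \<exists>\<kappa>>0. \<exists>C>0. \<forall>n. \<forall>dt. 0 < dt \<and> dt < dtstar \<longrightarrow>
    (let (x, p) = euler_iterate f \<gamma> c dt (x0, p0) n in
      f x - f xstar + (norm p)\<^sup>2 \<le> C * exp (- \<kappa> * real n * dt))"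
proof -
  have ev: "\<forall>x l. eigenvalue (hessian f x) l \<longrightarrow> m \<le> l \<and> l \<le> M"
    using assms(4) by blast
  have min: "f xstar \<le> f y" for y
    using assms(5) by (auto simp: is_arg_min_def not_less)
  have "M > 0" using assms by linarith
  note conv = convexity_at_minimizer[OF assms(1-3) ev min]
  define En where "En x p = f x - f xstar + (norm p)\<^sup>2 / 2" for x p :: "real ^ 'n"
  have En_nonneg: "0 \<le> En x p" for x p
    using min[of x] by (simp add: En_def)
  define E0 where "E0 = En x0 p0"
  \<comment> \<open>On the set \<open>W x p \<le> 2 * E0\<close> the squared momentum is at most
    \<open>2 * En x p\<close>, hence at most \<open>8 * E0\<close>. So \<open>K\<close> is a linear
    bound for the whole friction there.\<close>
  define K where "K = \<gamma> + c * (8 * E0)"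
  \<comment> \<open>The first argument ensures equivalence of \<open>W\<close> and
    \<open>En\<close>, the second the dissipation estimate.\<close>
  define b where "b = min (1 / (2 * (1 + 1 / m))) (\<gamma> / (2 * (1 + K\<^sup>2 / (2 * m))))"
  have pos1: "0 < 1 + 1 / m" and pos2: "0 < 1 + K\<^sup>2 / (2 * m)"
    using \<open>0 < m\<close> by (auto intro: add_pos_nonneg)
  have "0 < b"
    using pos1 pos2 \<open>\<gamma> > 0\<close> unfolding b_def by simp
  have b1: "b * (1 + 1 / m) \<le> 1 / 2"
  proof -
    have "b \<le> 1 / (2 * (1 + 1 / m))" by (simp add: b_def)
    then show ?thesis using pos1 by (simp add: pos_le_divide_eq algebra_simps)
  qed
  have b2: "b * (1 + K\<^sup>2 / (2 * m)) \<le> \<gamma> / 2"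
  proof -
    have "b \<le> \<gamma> / (2 * (1 + K\<^sup>2 / (2 * m)))" by (simp add: b_def)
    then show ?thesis using pos2 by (simp add: pos_le_divide_eq algebra_simps)
  qed
  have "b \<le> b * (1 + 1 / m)"
    using \<open>0 < b\<close> \<open>0 < m\<close> by simp
  then have "b \<le> 1" using b1 by linarith
  define \<beta> where "\<beta> = min \<gamma> b"
  have "0 < \<beta>" "\<beta> \<le> \<gamma>" "\<beta> \<le> b"
    using \<open>0 < b\<close> \<open>\<gamma> > 0\<close> by (auto simp: \<beta>_def)
  define A where "A = 1 + 4 * K\<^sup>2 + 5 * M"
  have "0 < A"
    using \<open>M > 0\<close> by (auto simp: A_def intro!: add_pos_pos add_pos_nonneg)
  define W where "W x p = En x p + b * (p \<bullet> (x - xstar))" for x p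
  have W: "En x p / 2 \<le> W x p" "W x p \<le> 2 * En x p" for x p
    unfolding W_def En_def
    by (intro modified_energy_equivalent[OF \<open>0 < m\<close> \<open>0 < b\<close> b1 conv(1)])+
  have step: "W (x + dt *\<^sub>R p) ((1 - \<gamma> * dt) *\<^sub>R p - (c * dt) *\<^sub>R vec_cube p - dt *\<^sub>R grad f x)
      \<le> (1 - \<beta> / 4 * dt) * W x p"
    if dt: "0 < dt" "dt < \<beta> / (2 * A)" and Wx: "W x p \<le> 2 * E0" for x p dt
  proof -
    define r where "r = \<gamma> *\<^sub>R p + c *\<^sub>R vec_cube p"
    have "(norm p)\<^sup>2 \<le> 2 * En x p"
      using min[of x] by (simp add: En_def)
    also have "\<dots> \<le> 8 * E0"
      using W(1)[of x p] Wx by simp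
    finally have "norm (vec_cube p) \<le> 8 * E0 * norm p"
      by (rule norm_vec_cube_le)
    then have "norm (c *\<^sub>R vec_cube p) \<le> c * (8 * E0 * norm p)"
      using \<open>c > 0\<close> by simp
    moreover have "norm (c *\<^sub>R vec_cube p) = c * norm (vec_cube p)" "norm (\<gamma> *\<^sub>R p) = \<gamma> * norm p"
      using \<open>\<gamma> > 0\<close> \<open>c > 0\<close> by simp_all
    ultimately have r1: "norm r \<le> K * norm p"
      using norm_triangle_ineq[of "\<gamma> *\<^sub>R p" "c *\<^sub>R vec_cube p"]
      unfolding r_def K_def by (simp only: distrib_right mult.assoc)
    have r2: "\<gamma> * (norm p)\<^sup>2 \<le> p \<bullet> r"
      using inner_vec_cube_nonneg[of p] \<open>c > 0\<close> by (simp add: r_def inner_add_right dot_square_norm)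
    have descent: "f (x + dt *\<^sub>R p) - f xstar
        \<le> f x - f xstar + dt * (p \<bullet> grad f x) + M / 2 * (dt\<^sup>2 * (norm p)\<^sup>2)"
      using taylor_hessian_bounds(2)[OF \<open>C2 f\<close> ev, of x "dt *\<^sub>R p"] by (simp add: power_mult_distrib)
    have p': "(1 - \<gamma> * dt) *\<^sub>R p - (c * dt) *\<^sub>R vec_cube p - dt *\<^sub>R grad f x = p - dt *\<^sub>R (r + grad f x)"
      by (simp add: r_def algebra_simps)
    have shift: "x + dt *\<^sub>R p - xstar = (x - xstar) + dt *\<^sub>R p"
      by simp
    have "W (x + dt *\<^sub>R p) ((1 - \<gamma> * dt) *\<^sub>R p - (c * dt) *\<^sub>R vec_cube p - dt *\<^sub>R grad f x)
        \<le> W x p - dt * \<beta> * En x p + dt\<^sup>2 * A * En x p"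
      using modified_energy_step[OF \<open>0 < m\<close> less_imp_le[OF \<open>M > 0\<close>] _ dt(1) \<open>0 < b\<close> \<open>b \<le> 1\<close> r2 r1
          conv(3) conv(2) descent b2 \<open>\<beta> \<le> \<gamma>\<close> \<open>\<beta> \<le> b\<close> refl] min[of x]
      unfolding W_def En_def A_def p' shift by simp
    \<comment> \<open>The step-size restriction lets the remainder use up only half of the
      dissipation; passing from \<open>En\<close> to \<open>W\<close> with
      \<open>W \<le> 2 * En\<close> halves the rate again, whence
      \<open>\<beta> / 4\<close>.\<close>
    also have "dt\<^sup>2 * A * En x p \<le> dt * (\<beta> / 2) * En x p"
    proof -
      have "dt * A \<le> \<beta> / 2"
        using dt \<open>0 < A\<close> by (simp add: field_simps)
      then have "dt * (dt * A) * En x p \<le> dt * (\<beta> / 2) * En x p"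
        using dt by (intro mult_right_mono mult_left_mono En_nonneg) auto
      then show ?thesis
        by (simp add: power2_eq_square ac_simps)
    qed
    also have "W x p - dt * \<beta> * En x p + dt * (\<beta> / 2) * En x p = W x p - dt * \<beta> / 4 * (2 * En x p)"
      by (simp add: algebra_simps)
    also have "\<dots> \<le> W x p - dt * \<beta> / 4 * W x p"
      using W(2)[of x p] dt \<open>0 < \<beta>\<close> by (intro diff_left_mono mult_left_mono) auto
    finally show ?thesis
      by (simp add: algebra_simps)
  qed
  \<comment> \<open>The exponential bound also implies \<open>W x p \<le> 2 * E0\<close>, so the
    induction hypothesis itself keeps the iterates in the region where \<open>step\<close>
    applies.\<close>
  have decay: "case euler_iterate f \<gamma> c dt (x0, p0) n of (x, p) \<Rightarrow>
      W x p \<le> 2 * E0 * exp (- (\<beta> / 4) * real n * dt)"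
    if dt: "0 < dt" "dt < \<beta> / (2 * A)" for dt n
  proof (induction n)
    case 0
    then show ?case
      using W(2)[of x0 p0] by (simp add: E0_def)
  next
    case (Suc n)
    obtain x p where xp: "euler_iterate f \<gamma> c dt (x0, p0) n = (x, p)"
      by (cases "euler_iterate f \<gamma> c dt (x0, p0) n")
    let ?e = "exp (- (\<beta> / 4) * real n * dt)"
    have IH: "W x p \<le> 2 * E0 * ?e"
      using Suc by (simp add: xp)
    have "?e \<le> 1"
      using \<open>0 < \<beta>\<close> dt by simp
    then have "2 * E0 * ?e \<le> 2 * E0"
      using En_nonneg[of x0 p0] by (simp add: E0_def mult_left_le)
    then have "W x p \<le> 2 * E0"
      using IH by linarith
    have "W (x + dt *\<^sub>R p) ((1 - \<gamma> * dt) *\<^sub>R p - (c * dt) *\<^sub>R vec_cube p - dt *\<^sub>R grad f x)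
        \<le> (1 - \<beta> / 4 * dt) * W x p"
      by (rule step[OF dt \<open>W x p \<le> 2 * E0\<close>])
    \<comment> \<open>Since \<open>W\<close> is nonnegative, \<open>1 - s \<le> exp (- s)\<close>
      can be used without knowing the sign of \<open>1 - s\<close>.\<close>
    also have "\<dots> \<le> exp (- (\<beta> / 4 * dt)) * W x p"
      using W(1)[of x p] En_nonneg[of x p] exp_ge_add_one_self[of "- (\<beta> / 4 * dt)"]
      by (intro mult_right_mono) auto
    also have "\<dots> \<le> exp (- (\<beta> / 4 * dt)) * (2 * E0 * ?e)"
      by (intro mult_left_mono IH) simp
    also have "\<dots> = 2 * E0 * exp (- (\<beta> / 4) * real (Suc n) * dt)"
      by (simp add: algebra_simps flip: exp_add)
    finally show ?case
      by (simp add: xp)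
  qed
  show ?thesis
  proof (intro exI conjI allI impI)
    show "0 < \<beta> / (2 * A)" "0 < \<beta> / 4"
      using \<open>0 < \<beta>\<close> \<open>0 < A\<close> by simp_all
    \<comment> \<open>The added 1 keeps the constant positive when the initial energy
      vanishes.\<close>
    show "0 < 8 * E0 + 1"
      using En_nonneg[of x0 p0] by (simp add: E0_def)
    fix n dt assume dt: "0 < dt \<and> dt < \<beta> / (2 * A)"
    obtain x p where xp: "euler_iterate f \<gamma> c dt (x0, p0) n = (x, p)"
      by (cases "euler_iterate f \<gamma> c dt (x0, p0) n")
    let ?e = "exp (- (\<beta> / 4) * real n * dt)"
    have "f x - f xstar + (norm p)\<^sup>2 \<le> 2 * En x p"
      using min[of x] by (simp add: En_def)
    also have "\<dots> \<le> 4 * W x p"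
      using W(1)[of x p] by simp
    also have "\<dots> \<le> 8 * E0 * ?e"
      using decay[of dt n] dt by (simp add: xp)
    also have "\<dots> \<le> (8 * E0 + 1) * ?e"
      by simp
    finally show "let (x, p) = euler_iterate f \<gamma> c dt (x0, p0) n in
        f x - f xstar + (norm p)\<^sup>2 \<le> (8 * E0 + 1) * ?e"
      by (simp add: xp)
  qed
qed

end
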